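(* Let $n\ge1$, let $\lambda\in X_+$ be a dominant weight of type $A_n$, let $m\in\mathbb{Z}_{\ge0}$, and let $t=t_{m+1}$ be the reflection in the affine Weyl group whose positive root $\alpha_t^\vee$ is the $(m+1)$-st root in the list $$\delta-\alpha_{1,n}^\vee,\ \delta-\alpha_{2,n}^\vee,\ \dots,\ \delta-\alpha_{n,n}^\vee,\ 2\delta-\alpha_{1,n}^\vee,\ 2\delta-\alpha_{2,n}^\vee,\ \dots$$ Then for every $\mu\in X$ with $\mu<t\mu\le\lambda$ (Bruhat order on $X$), $$\mathrm{Arr}_m(\mu,\lambda)=\mathrm{Arr}_m(t\mu,\lambda)-1,$$ where $\mathrm{Arr}_m(\nu,\lambda)$ denotes the number of arrows directed to $\nu$ in the twisted Bruhat graph $\Gamma^m_\lambda$. In other words, for each edge reversed in passing from $\Gamma^m_\lambda$ to $\Gamma^{m+1}_\lambda$, the difference of the in-degrees in $\Gamma^m_\lambda$ of its two vertices is $1$.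
   Context: $X$ is the weight lattice of $SL_{n+1}(\mathbb{C})$, $\Phi\subset X$ its root system (type $A_n$) with simple roots $\alpha_1,\dots,\alpha_n$; the positive roots are $\alpha_{j,k}=\alpha_j+\dots+\alpha_k$ ($1\le j\le k\le n$), with coroots $\alpha_{j,k}^\vee=\alpha_j^\vee+\dots+\alpha_k^\vee$; $X_+$ is the set of dominant weights. Affine roots: the real roots are $m\delta+\beta^\vee$ ($\beta\in\Phi$, $m\in\mathbb{Z}$); the positive ones are those with $m>0$, or $m=0$ and $\beta\in\Phi_+$. They are in bijection with the reflections of the affine Weyl group $W\ltimes\mathbb{Z}\Phi$ acting on $X$ by $s_{m\delta+\beta^\vee}(\mu)=\mu-(\langle\mu,\beta^\vee\rangle-m)\beta$. Bruhat order on $X$: the partial order generated by $\nu<\mu$ whenever $\mu-\nu=k\beta$ with $\beta\in\Phi_+$, $k\in\mathbb{Z}$, and either $\langle\mu,\beta^\vee\rangle\ge k>0$ or $\langle\mu,\beta^\vee\rangle<k<0$. Two distinct weights exchanged by a reflection are always comparable. Bruhat graph $\Gamma_\lambda$: its vertices are the weights $\nu\le\lambda$; there is an arrow $\nu\to\nu'$, labelled by the positive real root $\alpha^\vee$, whenever $s_{\alpha^\vee}(\nu)=\nu'$ and $\nu<\nu'$. The twisted Bruhat graph $\Gamma^m_\lambda$ is obtained from $\Gamma_\lambda$ by reversing all arrows whose label is among the first $m$ roots of the list in the claim. *)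

theory Defs
  imports "Graph_Theory.Digraph"
begin

text \<open>
  A weight \<open>\<mu>\<close> of type \<open>A\<^sub>n\<close> is given by its coordinates with respect to the fundamental weights,
  that is, \<open>\<mu> i\<close> is the pairing of \<open>\<mu>\<close> with the \<open>i\<close>-th simple coroot, for \<open>1 \<le> i \<le> n\<close>.
\<close>

type_synonym weight = "nat \<Rightarrow> int"

definition weight_lattice :: "nat \<Rightarrow> weight set" where
  "weight_lattice n = {\<mu>. \<forall>i. i \<notin> {1..n} \<longrightarrow> \<mu> i = 0}"

definition dominant_weights :: "nat \<Rightarrow> weight set" where
  "dominant_weights n = {\<mu> \<in> weight_lattice n. \<forall>i\<in>{1..n}. 0 \<le> \<mu> i}"

text \<open>
  A root \<open>\<beta>\<close> is given by its coefficients on the simple roots.  In type \<open>A\<close> these are also the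
  coefficients of its coroot on the simple coroots, so the same function encodes both;
  \<open>root_weight\<close> is the root as an element of the weight lattice, and \<open>coroot_pairing\<close> pairs a weight
  with the coroot.
\<close>

type_synonym root = "nat \<Rightarrow> int"

definition cartan :: "nat \<Rightarrow> nat \<Rightarrow> int" where
  "cartan i j = (if i = j then 2 else if i = Suc j \<or> j = Suc i then - 1 else 0)"

definition root_weight :: "nat \<Rightarrow> root \<Rightarrow> weight" where
  "root_weight n \<beta> = (\<lambda>i. if i \<in> {1..n} then \<Sum>j\<in>{1..n}. \<beta> j * cartan i j else 0)"

definition coroot_pairing :: "nat \<Rightarrow> weight \<Rightarrow> root \<Rightarrow> int" where
  "coroot_pairing n \<mu> \<beta> = (\<Sum>i\<in>{1..n}. \<beta> i * \<mu> i)"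

text \<open>The root \<open>\<alpha>\<^sub>j + \<dots> + \<alpha>\<^sub>k\<close>.\<close>

definition alpha :: "nat \<Rightarrow> nat \<Rightarrow> root" where
  "alpha j k = (\<lambda>i. if i \<in> {j..k} then 1 else 0)"

definition neg_root :: "root \<Rightarrow> root" where
  "neg_root \<beta> = (\<lambda>i. - \<beta> i)"

definition pos_roots :: "nat \<Rightarrow> root set" where
  "pos_roots n = {alpha j k | j k. 1 \<le> j \<and> j \<le> k \<and> k \<le> n}"

definition roots :: "nat \<Rightarrow> root set" where
  "roots n = pos_roots n \<union> neg_root ` pos_roots n"

text \<open>The pair \<open>(m, \<beta>)\<close> stands for the affine real root \<open>m\<delta> + \<beta>\<^sup>\<or>\<close>.\<close>

type_synonym affine_root = "int \<times> root"

definition pos_real_roots :: "nat \<Rightarrow> affine_root set" where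
  "pos_real_roots n = {(m, \<beta>). \<beta> \<in> roots n \<and> (0 < m \<or> m = 0 \<and> \<beta> \<in> pos_roots n)}"

fun affine_reflection :: "nat \<Rightarrow> affine_root \<Rightarrow> weight \<Rightarrow> weight" where
  "affine_reflection n (m, \<beta>) \<mu> =
     (\<lambda>i. \<mu> i - (coroot_pairing n \<mu> \<beta> - m) * root_weight n \<beta> i)"

definition bruhat_step :: "nat \<Rightarrow> weight \<Rightarrow> weight \<Rightarrow> bool" where
  "bruhat_step n \<nu> \<mu> \<longleftrightarrow> \<nu> \<in> weight_lattice n \<and> \<mu> \<in> weight_lattice n \<and>
     (\<exists>\<beta>\<in>pos_roots n. \<exists>k::int. (\<forall>i. \<mu> i - \<nu> i = k * root_weight n \<beta> i) \<and>
        (coroot_pairing n \<mu> \<beta> \<ge> k \<and> k > 0 \<or> coroot_pairing n \<mu> \<beta> < k \<and> k < 0))"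

definition bruhat_le :: "nat \<Rightarrow> weight \<Rightarrow> weight \<Rightarrow> bool" where
  "bruhat_le n = (bruhat_step n)\<^sup>*\<^sup>*"

definition bruhat_less :: "nat \<Rightarrow> weight \<Rightarrow> weight \<Rightarrow> bool" where
  "bruhat_less n \<nu> \<mu> \<longleftrightarrow> bruhat_le n \<nu> \<mu> \<and> \<nu> \<noteq> \<mu>"

text \<open>An arrow is a triple (source, label, target).\<close>

type_synonym arrow = "weight \<times> affine_root \<times> weight"

definition bruhat_graph :: "nat \<Rightarrow> weight \<Rightarrow> (weight, arrow) pre_digraph" where
  "bruhat_graph n lam =
     \<lparr> verts = {\<nu> \<in> weight_lattice n. bruhat_le n \<nu> lam},
       arcs = {(\<nu>, a, \<nu>'). \<nu> \<in> weight_lattice n \<and> bruhat_le n \<nu> lam \<and>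
                           \<nu>' \<in> weight_lattice n \<and> bruhat_le n \<nu>' lam \<and>
                           a \<in> pos_real_roots n \<and>
                           affine_reflection n a \<nu> = \<nu>' \<and> bruhat_less n \<nu> \<nu>'},
       tail = (\<lambda>(\<nu>, a, \<nu>'). \<nu>),
       head = (\<lambda>(\<nu>, a, \<nu>'). \<nu>') \<rparr>"

text \<open>
  The list \<open>\<delta> - \<alpha>\<^sub>1\<^sub>,\<^sub>n\<^sup>\<or>, \<dots>, \<delta> - \<alpha>\<^sub>n\<^sub>,\<^sub>n\<^sup>\<or>, 2\<delta> - \<alpha>\<^sub>1\<^sub>,\<^sub>n\<^sup>\<or>, \<dots>\<close>, indexed from 0.
\<close>

definition twist_root :: "nat \<Rightarrow> nat \<Rightarrow> affine_root" where
  "twist_root n i = (int (i div n) + 1, neg_root (alpha (i mod n + 1) n))"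

text \<open>
  Reversing an arrow exchanges its tail and head; the triple naming it is unchanged.
\<close>

definition twisted_bruhat_graph :: "nat \<Rightarrow> nat \<Rightarrow> weight \<Rightarrow> (weight, arrow) pre_digraph" where
  "twisted_bruhat_graph n m lam =
     (let G = bruhat_graph n lam;
          reversed = (\<lambda>(\<nu>, a, \<nu>'). a \<in> twist_root n ` {..<m})
      in \<lparr> verts = verts G, arcs = arcs G,
           tail = (\<lambda>e. if reversed e then head G e else tail G e),
           head = (\<lambda>e. if reversed e then tail G e else head G e) \<rparr>)"

definition Arr :: "nat \<Rightarrow> nat \<Rightarrow> weight \<Rightarrow> weight \<Rightarrow> nat" where
  "Arr n m \<nu> lam = in_degree (twisted_bruhat_graph n m lam) \<nu>"

end

theory Submission
  imports Defs
begin

text \<open>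
  A weight of type \<open>A\<^sub>n\<close> below \<open>\<lambda>\<close> lifts uniquely to an integer vector \<open>X\<close> with entries
  \<open>X\<^sub>1, \<dots>, X\<^sub>n\<^sub>+\<^sub>1\<close> whose sum is that of a fixed lift \<open>L\<close> of \<open>\<lambda>\<close>.  The positive roots become
  \<open>e\<^sub>i - e\<^sub>j\<close> with \<open>i < j\<close>, the pairing with such a coroot is \<open>X\<^sub>i - X\<^sub>j\<close>, and every weight that a
  reflection exchanges with \<open>X\<close> is \<open>X - k (e\<^sub>i - e\<^sub>j)\<close> for some \<open>k \<noteq> 0\<close>.  For dominant \<open>\<lambda>\<close> the weights
  below \<open>\<lambda>\<close> are exactly the vectors majorised by \<open>L\<close> (\<open>majorised_iff_below\<close>), and majorisation is
  tested by functions that are sums over the entries, the excesses \<open>\<Sum>\<^sub>i max 0 (X\<^sub>i - \<theta>)\<close>.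

  On the string of \<open>e\<^sub>i - e\<^sub>j\<close> through \<open>X\<close>, reversing the first \<open>m\<close> labels translates the Bruhat order:
  \<open>X - k (e\<^sub>i - e\<^sub>j)\<close> has an arrow to \<open>X\<close> iff \<open>0 < k \<le> P\<close> or \<open>P < k < 0\<close>, where
  \<open>P = X\<^sub>i - X\<^sub>j + s\<close> and \<open>s\<close> is the number of reversed labels belonging to \<open>e\<^sub>i - e\<^sub>j\<close>.  That makes
  \<open>P\<close> arrows if \<open>P \<ge> 0\<close> and \<open>- 1 - P\<close> otherwise, less those whose source is not majorised by \<open>L\<close>
  (\<open>Arr_eq_sum\<close>, \<open>card_in_moves\<close>).

  Let \<open>t\<close> be the next reflection, of label \<open>(c + 1)\<delta> - \<alpha>\<^sub>J\<^sub>,\<^sub>n\<^sup>\<or>\<close>.  Without the constraint of lying below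
  \<open>\<lambda>\<close> the claim would say that this label is simple for the twisted order: \<open>t\<close> matches
  the string of \<open>e\<^sub>i - e\<^sub>n\<^sub>+\<^sub>1\<close> through \<open>X\<close> with that of \<open>\<plusminus>(e\<^sub>i - e\<^sub>J)\<close> through \<open>t X\<close> and conversely,
  preserving the number of arrows, while on its own string \<open>X\<close> and \<open>t X\<close> are neighbours in the
  twisted order, so \<open>t X\<close> receives exactly one arrow more.  The weights below \<open>\<lambda>\<close> are not stable
  under \<open>t\<close>, so this matching does not respect the constraint.  What saves the count is that only the
  strings of \<open>e\<^sub>i - e\<^sub>n\<^sub>+\<^sub>1\<close> lose arrows to the constraint, and that for each \<open>i\<close> the string through \<open>X\<close>
  loses as many as the one through \<open>t X\<close> (\<open>lost_eq\<close>); this holds because \<open>t X\<close> itself is below \<open>\<lambda>\<close>.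
\<close>

\<comment> \<open>Sums over the \<open>n + 1\<close> entries are split at the entries that a move changes, not at the last one.\<close>
declare sum.cl_ivl_Suc [simp del]

section \<open>Weights as integer vectors of fixed sum\<close>

definition gl_weights :: "nat \<Rightarrow> weight set" where
  "gl_weights n = {X. \<forall>i. i \<notin> {1..Suc n} \<longrightarrow> X i = 0}"

definition weight_of :: "nat \<Rightarrow> weight \<Rightarrow> weight" where
  "weight_of n X = (\<lambda>i. if i \<in> {1..n} then X i - X (Suc i) else 0)"

definition total :: "nat \<Rightarrow> weight \<Rightarrow> int" where
  "total n X = (\<Sum>i\<in>{1..Suc n}. X i)"

definition move :: "nat \<Rightarrow> nat \<Rightarrow> int \<Rightarrow> weight \<Rightarrow> weight" where
  "move i j k X = X(i := X i - k, j := X j + k)"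

lemma weight_of_in_lattice: "weight_of n X \<in> weight_lattice n"
  by (simp add: weight_of_def weight_lattice_def)

lemma move_in_gl_weights:
  assumes "X \<in> gl_weights n" "1 \<le> i" "i < j" "j \<le> Suc n"
  shows "move i j k X \<in> gl_weights n"
  using assms by (auto simp: move_def gl_weights_def)

lemma move_move: "i \<noteq> j \<Longrightarrow> move i j k (move i j k' X) = move i j (k + k') X"
  by (auto simp: move_def fun_eq_iff)

lemma move_zero: "move i j 0 X = X"
  by (simp add: move_def)

lemma sum_move:
  fixes g :: "nat \<Rightarrow> int \<Rightarrow> int"
  assumes "1 \<le> i" "i < j" "j \<le> Suc n"
  shows "(\<Sum>l\<in>{1..Suc n}. g l (move i j k X l)) =
    (\<Sum>l\<in>{1..Suc n}. g l (X l)) - g i (X i) - g j (X j) + g i (X i - k) + g j (X j + k)"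
proof -
  let ?A = "{1..Suc n}" and ?B = "{1..Suc n} - {i} - {j}"
  have split: "(\<Sum>l\<in>?A. h l) = h i + (h j + (\<Sum>l\<in>?B. h l))" for h :: "nat \<Rightarrow> int"
  proof -
    have "(\<Sum>l\<in>?A. h l) = h i + (\<Sum>l\<in>?A - {i}. h l)"
      using assms by (intro sum.remove) auto
    also have "(\<Sum>l\<in>?A - {i}. h l) = h j + (\<Sum>l\<in>?B. h l)"
      using assms by (intro sum.remove) auto
    finally show ?thesis .
  qed
  have "(\<Sum>l\<in>?B. g l (move i j k X l)) = (\<Sum>l\<in>?B. g l (X l))"
    by (rule sum.cong) (auto simp: move_def)
  moreover have "move i j k X i = X i - k" "move i j k X j = X j + k"
    using assms by (auto simp: move_def)
  ultimately show ?thesis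
    using split[of "\<lambda>l. g l (move i j k X l)"] split[of "\<lambda>l. g l (X l)"] by simp
qed

lemma total_move:
  assumes "1 \<le> i" "i < j" "j \<le> Suc n"
  shows "total n (move i j k X) = total n X"
  using sum_move[OF assms, of "\<lambda>l x. x" k X] by (simp add: total_def)

text \<open>
  Two lifts of the same weight differ by a constant vector, and fixing the sum fixes the constant.
\<close>

lemma weight_of_inject:
  assumes "X \<in> gl_weights n" "Y \<in> gl_weights n" "total n X = total n Y"
    and eq: "weight_of n X = weight_of n Y"
  shows "X = Y"
proof -
  have step: "X i - X (Suc i) = Y i - Y (Suc i)" if "i \<in> {1..n}" for i
    using fun_cong[OF eq, of i] that by (simp add: weight_of_def)
  have const: "X (Suc l) - Y (Suc l) = X 1 - Y 1" if "l \<le> n" for l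
    using that
  proof (induction l)
    case (Suc l)
    then show ?case using step[of "Suc l"] by simp
  qed simp
  have "X i - Y i = X 1 - Y 1" if "i \<in> {1..Suc n}" for i
    using const[of "i - 1"] that by auto
  then have "(\<Sum>i\<in>{1..Suc n}. X i - Y i) = (\<Sum>i\<in>{1..Suc n}. X 1 - Y 1)"
    by (rule sum.cong[OF refl])
  moreover have "(\<Sum>i\<in>{1..Suc n}. X i - Y i) = 0"
    using assms(3) by (simp add: sum_subtractf total_def)
  ultimately have "X 1 = Y 1" by simp
  show ?thesis
  proof
    fix i show "X i = Y i"
    proof (cases "i \<in> {1..Suc n}")
      case True
      then show ?thesis using \<open>X 1 = Y 1\<close> const[of "i - 1"] by auto
    next
      case False
      then show ?thesis using assms(1,2) by (simp add: gl_weights_def)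
    qed
  qed
qed

text \<open>
  In the coordinates above this is \<open>e\<^sub>i - e\<^sub>j\<close>, hence the shift from the index \<open>j - 1\<close> of the last
  simple root.
\<close>

definition diff_root :: "nat \<Rightarrow> nat \<Rightarrow> root" where
  "diff_root i j = alpha i (j - 1)"

lemma coroot_pairing_weight_of:
  assumes "1 \<le> i" "i < j" "j \<le> Suc n"
  shows "coroot_pairing n (weight_of n X) (diff_root i j) = X i - X j"
proof -
  have "coroot_pairing n (weight_of n X) (diff_root i j) = (\<Sum>l\<in>{i..<j}. X l - X (Suc l))"
    unfolding coroot_pairing_def
    by (rule sum.mono_neutral_cong_right) (use assms in \<open>auto simp: diff_root_def alpha_def weight_of_def\<close>)
  also have "\<dots> = X i - X j"
    using sum_Suc_diff'[of i j "\<lambda>l. - X l"] assms by simp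
  finally show ?thesis .
qed

lemma root_weight_alpha:
  assumes "1 \<le> i" "i < j" "j \<le> Suc n" "l \<in> {1..n}"
  shows "root_weight n (diff_root i j) l =
    of_bool (l = i) - of_bool (l = j) - of_bool (Suc l = i) + of_bool (Suc l = j)"
proof -
  have "root_weight n (diff_root i j) l = (\<Sum>q\<in>{i..<j}. cartan l q)"
    using assms(4) unfolding root_weight_def
    by simp (rule sum.mono_neutral_cong_right, use assms in \<open>auto simp: diff_root_def alpha_def\<close>)
  also have "\<dots> = (\<Sum>q\<in>{i..<j}. (of_bool (l = q) - of_bool (l = Suc q))
      + (of_bool (Suc l = Suc q) - of_bool (Suc l = q)))"
    by (rule sum.cong) (auto simp: cartan_def)
  also have "\<dots> = (\<Sum>q\<in>{i..<j}. of_bool (l = q) - of_bool (l = Suc q))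
      + (\<Sum>q\<in>{i..<j}. of_bool (Suc l = Suc q) - of_bool (Suc l = q))"
    by (rule sum.distrib)
  also have "(\<Sum>q\<in>{i..<j}. of_bool (l = q) - of_bool (l = Suc q)) = (of_bool (l = i) - of_bool (l = j) :: int)"
    using sum_Suc_diff'[of i j "\<lambda>q. - of_bool (l = q) :: int"] assms by simp
  also have "(\<Sum>q\<in>{i..<j}. of_bool (Suc l = Suc q) - of_bool (Suc l = q)) = (of_bool (Suc l = j) - of_bool (Suc l = i) :: int)"
    using sum_Suc_diff'[of i j "\<lambda>q. of_bool (Suc l = q) :: int"] assms by simp
  finally show ?thesis by simp
qed

lemma weight_of_move:
  assumes "1 \<le> i" "i < j" "j \<le> Suc n"
  shows "weight_of n (move i j k X) = (\<lambda>l. weight_of n X l - k * root_weight n (diff_root i j) l)"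
proof
  fix l
  show "weight_of n (move i j k X) l = weight_of n X l - k * root_weight n (diff_root i j) l"
  proof (cases "l \<in> {1..n}")
    case True
    show ?thesis
      using assms True by (auto simp: root_weight_alpha[OF assms True] weight_of_def move_def)
  next
    case False
    then show ?thesis by (auto simp: root_weight_def weight_of_def)
  qed
qed

lemma pos_roots_eq: "pos_roots n = {diff_root i j | i j. 1 \<le> i \<and> i < j \<and> j \<le> Suc n}"
proof (intro equalityI subsetI)
  fix \<beta> assume "\<beta> \<in> pos_roots n"
  then obtain i k where "1 \<le> i" "i \<le> k" "k \<le> n" "\<beta> = alpha i k" by (auto simp: pos_roots_def)
  then have "\<beta> = diff_root i (Suc k)" "1 \<le> i" "i < Suc k" "Suc k \<le> Suc n" by (auto simp: diff_root_def)
  then show "\<beta> \<in> {diff_root i j | i j. 1 \<le> i \<and> i < j \<and> j \<le> Suc n}" by blast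
next
  fix \<beta> assume "\<beta> \<in> {diff_root i j | i j. 1 \<le> i \<and> i < j \<and> j \<le> Suc n}"
  then obtain i j where "\<beta> = alpha i (j - 1)" "1 \<le> i" "i < j" "j \<le> Suc n"
    by (auto simp: diff_root_def)
  then have "\<beta> = alpha i (j - 1)" "1 \<le> i" "i \<le> j - 1" "j - 1 \<le> n" by auto
  then show "\<beta> \<in> pos_roots n" unfolding pos_roots_def by blast
qed

lemma reflection_pos:
  assumes "1 \<le> i" "i < j" "j \<le> Suc n"
  shows "affine_reflection n (r, diff_root i j) (weight_of n X) = weight_of n (move i j (X i - X j - r) X)"
  by (simp add: weight_of_move[OF assms] coroot_pairing_weight_of[OF assms])

lemma reflection_neg:
  assumes "1 \<le> i" "i < j" "j \<le> Suc n"
  shows "affine_reflection n (r, neg_root (diff_root i j)) (weight_of n X) = weight_of n (move i j (X i - X j + r) X)"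
proof -
  have "coroot_pairing n Y (neg_root \<beta>) = - coroot_pairing n Y \<beta>" for Y \<beta>
    by (simp add: coroot_pairing_def neg_root_def sum_negf)
  moreover have "root_weight n (neg_root \<beta>) l = - root_weight n \<beta> l" for \<beta> l
    by (simp add: root_weight_def neg_root_def sum_negf)
  ultimately show ?thesis
    by (simp add: weight_of_move[OF assms] coroot_pairing_weight_of[OF assms] fun_eq_iff algebra_simps)
qed

section \<open>The Bruhat order in vector coordinates\<close>

text \<open>
  The condition under which \<open>\<mu> - k\<beta>\<close> lies below \<open>\<mu>\<close> in the Bruhat order when \<open>\<langle>\<mu>, \<beta>\<^sup>\<or>\<rangle> = p\<close>; the
  same condition at a translated \<open>p\<close> governs the twisted graph.
\<close>

definition lowers :: "int \<Rightarrow> int \<Rightarrow> bool" where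
  "lowers p k \<longleftrightarrow> 0 < k \<and> k \<le> p \<or> p < k \<and> k < 0"

lemma bruhat_step_weight_of:
  "bruhat_step n \<nu> (weight_of n X) \<longleftrightarrow>
    (\<exists>i j k. 1 \<le> i \<and> i < j \<and> j \<le> Suc n \<and> lowers (X i - X j) k \<and> \<nu> = weight_of n (move i j k X))"
  (is "?L = ?R")
proof
  assume ?L
  then obtain i j k where ij: "1 \<le> i" "i < j" "j \<le> Suc n"
    and eq: "\<And>l. weight_of n X l - \<nu> l = k * root_weight n (diff_root i j) l"
    and c: "coroot_pairing n (weight_of n X) (diff_root i j) \<ge> k \<and> k > 0 \<or>
         coroot_pairing n (weight_of n X) (diff_root i j) < k \<and> k < 0"
    by (auto simp: bruhat_step_def pos_roots_eq)
  have "\<nu> = weight_of n (move i j k X)"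
    unfolding weight_of_move[OF ij] eq[symmetric] by simp
  then show ?R using ij c unfolding coroot_pairing_weight_of[OF ij] lowers_def by blast
next
  assume ?R
  then obtain i j k where ij: "1 \<le> i" "i < j" "j \<le> Suc n"
    and l: "lowers (X i - X j) k" and \<nu>: "\<nu> = weight_of n (move i j k X)" by blast
  have root: "diff_root i j \<in> pos_roots n" using ij by (auto simp: pos_roots_eq)
  have eq: "\<forall>q. weight_of n X q - \<nu> q = k * root_weight n (diff_root i j) q"
    unfolding \<nu> weight_of_move[OF ij] by simp
  have pairing: "coroot_pairing n (weight_of n X) (diff_root i j) \<ge> k \<and> k > 0 \<or>
         coroot_pairing n (weight_of n X) (diff_root i j) < k \<and> k < 0"
    using l unfolding coroot_pairing_weight_of[OF ij] lowers_def by blast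
  show ?L
    unfolding bruhat_step_def
    using root eq pairing weight_of_in_lattice \<nu> by metis
qed

definition square_sum :: "nat \<Rightarrow> weight \<Rightarrow> int" where
  "square_sum n X = (\<Sum>i\<in>{1..Suc n}. X i * X i)"

definition index_sum :: "nat \<Rightarrow> weight \<Rightarrow> int" where
  "index_sum n X = (\<Sum>i\<in>{1..Suc n}. int i * X i)"

text \<open>
  A Bruhat step up pulls two entries apart, which increases the sum of squares, or merely exchanges
  them; an exchange moves the larger entry to the front and so decreases the sum weighted by
  positions.
\<close>

definition rank_less :: "nat \<Rightarrow> weight \<Rightarrow> weight \<Rightarrow> bool" where
  "rank_less n X Y \<longleftrightarrow> square_sum n X < square_sum n Y \<or>
     square_sum n X = square_sum n Y \<and> index_sum n Y < index_sum n X"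

lemma rank_less_move:
  assumes ij: "1 \<le> i" "i < j" "j \<le> Suc n" and l: "lowers (X i - X j) k"
  shows "rank_less n (move i j k X) X"
proof -
  have "square_sum n (move i j k X) = square_sum n X - 2 * (k * (X i - X j - k))"
    using sum_move[OF ij, of "\<lambda>l x. x * x" k X] by (simp add: square_sum_def algebra_simps)
  moreover have "index_sum n (move i j k X) = index_sum n X + k * (int j - int i)"
    using sum_move[OF ij, of "\<lambda>l x. int l * x" k X] by (simp add: index_sum_def algebra_simps)
  moreover have "0 < k * (X i - X j - k) \<or> k * (X i - X j - k) = 0 \<and> k > 0"
    using l by (auto simp: lowers_def mult_neg_neg zero_less_mult_iff)
  moreover have "0 < k * (int j - int i)" if "k > 0" using that ij by simp
  ultimately show ?thesis by (auto simp: rank_less_def)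
qed

lemma bruhat_le_lift:
  assumes "bruhat_le n \<nu> (weight_of n X)" "X \<in> gl_weights n"
  shows "\<exists>Y\<in>gl_weights n. total n Y = total n X \<and> \<nu> = weight_of n Y \<and> (Y = X \<or> rank_less n Y X)"
  using assms(1) unfolding bruhat_le_def
proof (induction rule: converse_rtranclp_induct)
  case base
  then show ?case using assms(2) by blast
next
  case (step \<nu> \<nu>')
  then obtain Y where Y: "Y \<in> gl_weights n" "total n Y = total n X" "\<nu>' = weight_of n Y"
    "Y = X \<or> rank_less n Y X" by blast
  obtain i j k where ij: "1 \<le> i" "i < j" "j \<le> Suc n" and k: "lowers (Y i - Y j) k"
    and \<nu>: "\<nu> = weight_of n (move i j k Y)"
    using step(1) unfolding Y(3) bruhat_step_weight_of by blast
  have "rank_less n (move i j k Y) X"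
    using rank_less_move[OF ij k] Y(4) by (auto simp: rank_less_def)
  then show ?case
    using move_in_gl_weights[OF Y(1) ij] total_move[OF ij] Y(2) \<nu> by metis
qed

text \<open>
  The Bruhat order is defined as a closure, so its antisymmetry has to come from a strictly monotone
  rank.
\<close>

lemma bruhat_less_antisym:
  assumes "bruhat_less n (weight_of n Y) (weight_of n X)" "bruhat_less n (weight_of n X) (weight_of n Y)"
    and gl: "X \<in> gl_weights n" "Y \<in> gl_weights n" "total n Y = total n X"
  shows False
proof -
  have *: "rank_less n Y X" if less: "bruhat_less n (weight_of n Y) (weight_of n X)"
    and gl: "X \<in> gl_weights n" "Y \<in> gl_weights n" "total n Y = total n X" for X Y
  proof -
    obtain Z where "Z \<in> gl_weights n" "total n Z = total n X" "weight_of n Y = weight_of n Z"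
      "Z = X \<or> rank_less n Z X"
      using less bruhat_le_lift[OF _ gl(1)] unfolding bruhat_less_def by blast
    moreover from this have "Z = Y"
      using weight_of_inject[of Z n Y] gl by simp
    ultimately show ?thesis
      using less unfolding bruhat_less_def by blast
  qed
  have "rank_less n Y X" by (rule *) (use assms in auto)
  moreover have "rank_less n X Y" by (rule *) (use assms in auto)
  ultimately show False unfolding rank_less_def by linarith
qed

text \<open>
  Exactly one of \<open>lowers p k\<close> and its counterpart for the opposite move holds when \<open>k \<noteq> 0\<close>, so two
  weights on a common string are always comparable, and antisymmetry makes the direction explicit.
\<close>

lemma bruhat_less_move_iff:
  assumes X: "X \<in> gl_weights n" and ij: "1 \<le> i" "i < j" "j \<le> Suc n"
  shows "bruhat_less n (weight_of n (move i j k X)) (weight_of n X) \<longleftrightarrow> lowers (X i - X j) k"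
    and "bruhat_less n (weight_of n X) (weight_of n (move i j k X)) \<longleftrightarrow> k \<noteq> 0 \<and> \<not> lowers (X i - X j) k"
proof -
  let ?Y = "move i j k X"
  have Y: "?Y \<in> gl_weights n" "total n ?Y = total n X"
    using move_in_gl_weights[OF X ij] total_move[OF ij] by auto
  have undo: "move i j (- k) ?Y = X" using ij by (simp add: move_move move_zero)
  have diff: "?Y i - ?Y j = X i - X j - 2 * k" using ij by (simp add: move_def)
  have neq: "weight_of n ?Y \<noteq> weight_of n X" if "k \<noteq> 0"
  proof
    assume "weight_of n ?Y = weight_of n X"
    then have "?Y = X" using weight_of_inject Y X by blast
    then show False using that diff by simp
  qed
  have down: "bruhat_less n (weight_of n ?Y) (weight_of n X)" if "lowers (X i - X j) k"
  proof -
    have "bruhat_step n (weight_of n ?Y) (weight_of n X)"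
      unfolding bruhat_step_weight_of using that ij by blast
    moreover have "k \<noteq> 0" using that by (auto simp: lowers_def)
    ultimately show ?thesis
      using neq by (auto simp: bruhat_less_def bruhat_le_def)
  qed
  have up: "bruhat_less n (weight_of n X) (weight_of n ?Y)" if "k \<noteq> 0" "\<not> lowers (X i - X j) k"
  proof -
    have "lowers (?Y i - ?Y j) (- k)" using that unfolding diff by (auto simp: lowers_def)
    then have "bruhat_step n (weight_of n X) (weight_of n ?Y)"
      unfolding bruhat_step_weight_of using ij undo by metis
    then show ?thesis
      using neq[OF that(1)] by (auto simp: bruhat_less_def bruhat_le_def)
  qed
  have no_move: "\<not> bruhat_less n (weight_of n X) (weight_of n ?Y)" 
     "\<not> bruhat_less n (weight_of n ?Y) (weight_of n X)" if "k = 0"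
    using that by (auto simp: bruhat_less_def move_zero)
  note anti = bruhat_less_antisym[OF _ _ X Y]
  have low0: "k \<noteq> 0" if "lowers (X i - X j) k" using that by (auto simp: lowers_def)
  show "bruhat_less n (weight_of n ?Y) (weight_of n X) \<longleftrightarrow> lowers (X i - X j) k"
    using down up no_move anti low0 by blast
  show "bruhat_less n (weight_of n X) (weight_of n ?Y) \<longleftrightarrow> k \<noteq> 0 \<and> \<not> lowers (X i - X j) k"
    using down up no_move anti low0 by blast
qed

section \<open>Weights below a dominant weight and majorisation\<close>

definition excess :: "nat \<Rightarrow> weight \<Rightarrow> int \<Rightarrow> int" where
  "excess n X \<theta> = (\<Sum>i\<in>{1..Suc n}. max 0 (X i - \<theta>))"

text \<open>
  For vectors of equal sum, comparing the excesses at all thresholds is the same as comparing the sums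
  of the \<open>r\<close> largest entries for all \<open>r\<close>.  The excess has the advantage of being a sum over the
  entries, so a move changes it by four explicit terms, without any sorting.
\<close>

definition majorised :: "nat \<Rightarrow> weight \<Rightarrow> weight set" where
  "majorised n L = {X \<in> gl_weights n. total n X = total n L \<and> (\<forall>\<theta>. excess n X \<theta> \<le> excess n L \<theta>)}"

lemma excess_move:
  assumes "1 \<le> i" "i < j" "j \<le> Suc n"
  shows "excess n (move i j k X) \<theta> = excess n X \<theta> - max 0 (X i - \<theta>) - max 0 (X j - \<theta>)
    + max 0 (X i - k - \<theta>) + max 0 (X j + k - \<theta>)"
  using sum_move[OF assms, of "\<lambda>l x. max 0 (x - \<theta>)" k X] by (simp add: excess_def)

lemma move_in_majorised_iff:
  assumes "X \<in> gl_weights n" "total n X = total n L" "1 \<le> i" "i < j" "j \<le> Suc n"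
  shows "move i j k X \<in> majorised n L \<longleftrightarrow> (\<forall>\<theta>. excess n X \<theta> - max 0 (X i - \<theta>) - max 0 (X j - \<theta>)
    + max 0 (X i - k - \<theta>) + max 0 (X j + k - \<theta>) \<le> excess n L \<theta>)"
  using assms by (simp add: majorised_def move_in_gl_weights total_move excess_move)

text \<open>
  The two new entries lie between the two old ones, so convexity of \<open>max 0\<close> bounds the excess.
\<close>

lemma move_in_majorised:
  assumes X: "X \<in> majorised n L" and ij: "1 \<le> i" "i < j" "j \<le> Suc n"
    and k: "0 \<le> k \<and> k \<le> X i - X j \<or> X i - X j \<le> k \<and> k \<le> 0"
  shows "move i j k X \<in> majorised n L"
proof -
  have "excess n (move i j k X) \<theta> \<le> excess n X \<theta>" for \<theta>
    unfolding excess_move[OF ij] using k by (auto simp: max_def)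
  moreover have "excess n X \<theta> \<le> excess n L \<theta>" for \<theta>
    using X by (simp add: majorised_def)
  ultimately have "excess n (move i j k X) \<theta> \<le> excess n L \<theta>" for \<theta>
    by (meson order_trans)
  then show ?thesis
    using X move_in_gl_weights[OF _ ij] total_move[OF ij] by (simp add: majorised_def)
qed

lemma below_imp_majorised:
  assumes "bruhat_le n \<nu> (weight_of n L)" "L \<in> gl_weights n"
  shows "\<exists>Y\<in>majorised n L. \<nu> = weight_of n Y"
  using assms(1) unfolding bruhat_le_def
proof (induction rule: converse_rtranclp_induct)
  case base
  have "L \<in> majorised n L" using assms(2) by (simp add: majorised_def)
  then show ?case by blast
next
  case (step \<nu> \<nu>')
  then obtain Y where Y: "Y \<in> majorised n L" "\<nu>' = weight_of n Y" by blast
  obtain i j k where ij: "1 \<le> i" "i < j" "j \<le> Suc n" and k: "lowers (Y i - Y j) k"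
    and \<nu>: "\<nu> = weight_of n (move i j k Y)"
    using step(1) unfolding Y(2) bruhat_step_weight_of by blast
  have "move i j k Y \<in> majorised n L"
    using k by (intro move_in_majorised[OF Y(1) ij]) (auto simp: lowers_def)
  then show ?case using \<nu> by blast
qed

definition count_above :: "nat \<Rightarrow> weight \<Rightarrow> int \<Rightarrow> nat" where
  "count_above n X \<theta> = card {i \<in> {1..Suc n}. \<theta> < X i}"

text \<open>
  The slopes of the excess function count entries; they recover the multiset of entries.
\<close>

lemma excess_diff: "excess n X \<theta> - excess n X (\<theta> + 1) = int (count_above n X \<theta>)"
proof -
  have "excess n X \<theta> - excess n X (\<theta> + 1) = (\<Sum>i\<in>{1..Suc n}. if \<theta> < X i then 1 else 0)"
    unfolding excess_def sum_subtractf[symmetric] by (rule sum.cong) (auto simp: max_def)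
  also have "\<dots> = int (card {i \<in> {1..Suc n}. \<theta> < X i})"
    by (simp add: sum.If_cases Int_def)
  finally show ?thesis by (simp add: count_above_def)
qed

lemma majorised_bounds:
  assumes X: "X \<in> majorised n L"
  shows "X i \<le> excess n L 0" "- X i \<le> excess n L 0 - total n L" "0 \<le> excess n L 0" "0 \<le> excess n L 0 - total n L"
proof -
  have le: "excess n X 0 \<le> excess n L 0" and tot: "total n X = total n L"
    using X by (auto simp: majorised_def)
  have pos: "0 \<le> excess n X 0" by (auto simp: excess_def intro: sum_nonneg)
  have neg: "excess n X 0 - total n X = (\<Sum>i\<in>{1..Suc n}. max 0 (- X i))"
    unfolding excess_def total_def sum_subtractf[symmetric] by (rule sum.cong) (auto simp: max_def)
  then have npos: "0 \<le> excess n X 0 - total n X" by (auto intro: sum_nonneg)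
  show "0 \<le> excess n L 0" "0 \<le> excess n L 0 - total n L" using le tot pos npos by auto
  show "X i \<le> excess n L 0"
  proof (cases "i \<in> {1..Suc n}")
    case True
    have "max 0 (X i - 0) \<le> excess n X 0"
      unfolding excess_def by (rule member_le_sum) (use True in auto)
    then show ?thesis using le by simp
  next
    case False
    then have "X i = 0" using X by (simp add: majorised_def gl_weights_def)
    then show ?thesis using le pos by simp
  qed
  show "- X i \<le> excess n L 0 - total n L"
  proof (cases "i \<in> {1..Suc n}")
    case True
    have "max 0 (- X i) \<le> excess n X 0 - total n X"
      unfolding neg by (rule member_le_sum) (use True in auto)
    then show ?thesis using le tot by simp
  next
    case False
    then have "X i = 0" using X by (simp add: majorised_def gl_weights_def)
    then show ?thesis using le tot npos by simp
  qed
qed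

lemma excess_large:
  assumes "\<And>i. i \<in> {1..Suc n} \<Longrightarrow> X i \<le> \<theta>"
  shows "excess n X \<theta> = 0"
  unfolding excess_def by (rule sum.neutral) (use assms in auto)

lemma excess_small:
  assumes "\<And>i. i \<in> {1..Suc n} \<Longrightarrow> \<theta> \<le> X i"
  shows "excess n X \<theta> = total n X - int (Suc n) * \<theta>"
proof -
  have "excess n X \<theta> = (\<Sum>i\<in>{1..Suc n}. X i - \<theta>)"
    unfolding excess_def by (rule sum.cong) (use assms in auto)
  then show ?thesis by (simp add: sum_subtractf total_def)
qed

lemma majorised_self: "L \<in> gl_weights n \<Longrightarrow> L \<in> majorised n L"
  by (simp add: majorised_def)

text \<open>
  In a decreasing vector the positions of the entries above \<open>\<theta>\<close> form an initial segment, which is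
  determined by its size, hence by the excess.
\<close>

lemma decreasing_eq_if_excess_eq:
  assumes gl: "X \<in> gl_weights n" "Y \<in> gl_weights n"
    and dec: "\<And>i j. 1 \<le> i \<Longrightarrow> i \<le> j \<Longrightarrow> j \<le> Suc n \<Longrightarrow> X j \<le> X i"
      "\<And>i j. 1 \<le> i \<Longrightarrow> i \<le> j \<Longrightarrow> j \<le> Suc n \<Longrightarrow> Y j \<le> Y i"
    and ex: "\<And>\<theta>. excess n X \<theta> = excess n Y \<theta>"
  shows "X = Y"
proof
  fix i
  let ?A = "\<lambda>Z \<theta>. {i \<in> {1..Suc n}. (\<theta>::int) < Z i}"
  have card: "card (?A X \<theta>) = card (?A Y \<theta>)" for \<theta>
    using excess_diff[of n X \<theta>] excess_diff[of n Y \<theta>] ex by (simp add: count_above_def)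
  have nested: "?A X \<theta> \<subseteq> ?A Y \<theta> \<or> ?A Y \<theta> \<subseteq> ?A X \<theta>" for \<theta>
  proof (rule ccontr)
    assume "\<not> ?thesis"
    then obtain p q where p: "1 \<le> p" "p \<le> Suc n" "\<theta> < X p" "\<not> \<theta> < Y p"
      and q: "1 \<le> q" "q \<le> Suc n" "\<theta> < Y q" "\<not> \<theta> < X q" by auto
    show False
      using dec(1)[of q p] dec(2)[of p q] p q by (cases "p \<le> q") auto
  qed
  have A: "?A X \<theta> = ?A Y \<theta>" for \<theta>
    using nested[of \<theta>]
  proof
    assume "?A X \<theta> \<subseteq> ?A Y \<theta>" then show ?thesis by (intro card_subset_eq card) auto
  next
    assume "?A Y \<theta> \<subseteq> ?A X \<theta>" then show ?thesis by (intro card_subset_eq[symmetric] card[symmetric]) auto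
  qed
  show "X i = Y i"
  proof (cases "i \<in> {1..Suc n}")
    case True
    then have "\<theta> < X i \<longleftrightarrow> \<theta> < Y i" for \<theta> using A[of \<theta>] by blast
    from this[of "X i"] this[of "Y i"] show ?thesis by auto
  next
    case False
    then show ?thesis using gl by (simp add: gl_weights_def)
  qed
qed

text \<open>
  Pulling two entries \<open>x \<ge> y\<close> apart by one raises the excess by one on \<open>[y, x]\<close> and nowhere else.  So
  it suffices to find two entries inside an interval \<open>(u, v)\<close> on which the excess of \<open>X\<close> is strictly
  smaller than that of \<open>L\<close>.  On a maximal such interval equality at the ends forces the slopes of the
  two excess functions to differ at either end, in opposite directions, which leaves at least two entries
  of \<open>X\<close> in between.
\<close>

lemma ex_step_up_strict:
  assumes X: "X \<in> majorised n L" and strict: "excess n X \<theta>0 < excess n L \<theta>0" and L: "L \<in> gl_weights n"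
  shows "\<exists>i j k. 1 \<le> i \<and> i < j \<and> j \<le> Suc n \<and> k \<noteq> 0 \<and> \<not> lowers (X i - X j) k \<and> move i j k X \<in> majorised n L"
proof -
  define D where "D \<theta> = excess n L \<theta> - excess n X \<theta>" for \<theta>
  have gl: "X \<in> gl_weights n" and tot: "total n X = total n L" and D0: "0 \<le> D \<theta>" for \<theta>
    using X by (auto simp: majorised_def D_def)
  \<comment> \<open>All entries of \<open>X\<close> and \<open>L\<close> lie in \<open>[- B, B]\<close>, and so does \<open>\<theta>0\<close>; the excesses agree at both ends.\<close>
  define B where "B = max (excess n L 0) (excess n L 0 - total n L) + \<bar>\<theta>0\<bar>"
  have bnd: "Z i \<le> B" "- B \<le> Z i" if "Z \<in> majorised n L" for Z i
    using majorised_bounds(1,2)[OF that, of i] majorised_bounds(3,4)[OF that] by (auto simp: B_def)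
  have Dhigh: "D B = 0"
    using excess_large[of n X B] excess_large[of n L B] bnd[OF X] bnd[OF majorised_self[OF L]]
    by (simp add: D_def)
  have Dlow: "D (- B) = 0"
    using excess_small[of n "- B" X] excess_small[of n "- B" L] bnd[OF X] bnd[OF majorised_self[OF L]] tot
    by (simp add: D_def)
  have B\<theta>: "- B \<le> \<theta>0" "\<theta>0 \<le> B"
    using majorised_bounds(3,4)[OF X] by (auto simp: B_def)
  define u where "u = Max {\<theta> \<in> {- B..\<theta>0}. D \<theta> = 0}"
  define v where "v = Min {\<theta> \<in> {\<theta>0..B}. D \<theta> = 0}"
  have fin: "finite {\<theta> \<in> {- B..\<theta>0}. D \<theta> = 0}" "finite {\<theta> \<in> {\<theta>0..B}. D \<theta> = 0}"
    by (rule finite_subset[of _ "{- B..B}"]; use B\<theta> in auto)+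
  have "u \<in> {\<theta> \<in> {- B..\<theta>0}. D \<theta> = 0}"
    unfolding u_def by (rule Max_in[OF fin(1)]) (use Dlow B\<theta> in auto)
  moreover have "v \<in> {\<theta> \<in> {\<theta>0..B}. D \<theta> = 0}"
    unfolding v_def by (rule Min_in[OF fin(2)]) (use Dhigh B\<theta> in auto)
  moreover have "D \<theta>0 \<noteq> 0" using strict by (simp add: D_def)
  ultimately have u: "D u = 0" "- B \<le> u" "u < \<theta>0" and v: "D v = 0" "\<theta>0 < v" "v \<le> B"
    by (auto simp: order_less_le)
  have pos: "0 < D \<theta>" if "u < \<theta>" "\<theta> < v" for \<theta>
  proof -
    have "D \<theta> \<noteq> 0"
    proof
      assume z: "D \<theta> = 0"
      show False
      proof (cases "\<theta> \<le> \<theta>0")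
        case True
        then have "\<theta> \<le> u" unfolding u_def using z that u True by (intro Max_ge fin) auto
        then show False using that by simp
      next
        case False
        then have "v \<le> \<theta>" unfolding v_def using z that v False by (intro Min_le fin) auto
        then show False using that by simp
      qed
    qed
    then show ?thesis using D0[of \<theta>] by simp
  qed
  have Dd: "D (\<theta> + 1) - D \<theta> = int (count_above n X \<theta>) - int (count_above n L \<theta>)" for \<theta>
    using excess_diff[of n X \<theta>] excess_diff[of n L \<theta>] by (simp add: D_def)
  have cu: "count_above n L u + 1 \<le> count_above n X u"
    using Dd[of u] u pos[of "u + 1"] v by simp
  have cv: "count_above n X (v - 1) + 1 \<le> count_above n L (v - 1)"
    using Dd[of "v - 1"] v pos[of "v - 1"] u by simp
  have cL: "count_above n L (v - 1) \<le> count_above n L u"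
    unfolding count_above_def by (rule card_mono) (use u v in auto)
  let ?M = "{i \<in> {1..Suc n}. u < X i \<and> X i < v}"
  have "?M = {i \<in> {1..Suc n}. u < X i} - {i \<in> {1..Suc n}. v - 1 < X i}" by auto
  moreover have "card \<dots> = count_above n X u - count_above n X (v - 1)"
    unfolding count_above_def by (rule card_Diff_subset) (use u v in auto)
  ultimately have "\<not> card ?M \<le> Suc 0" using cu cv cL by simp
  moreover have "finite ?M" by simp
  ultimately obtain i' j' where "i' \<in> ?M" "j' \<in> ?M" "i' \<noteq> j'"
    using card_le_Suc0_iff_eq by blast
  then obtain i j where ij: "1 \<le> i" "i < j" "j \<le> Suc n" and Xi: "u < X i" "X i < v" and Xj: "u < X j" "X j < v"
    using that[of i' j'] that[of j' i'] by (cases "i' < j'") auto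
  \<comment> \<open>The larger entry grows, whichever of the two positions it has.\<close>
  define k :: int where "k = (if X j \<le> X i then - 1 else 1)"
  have "\<not> lowers (X i - X j) k" "k \<noteq> 0"
    by (auto simp: k_def lowers_def)
  moreover have "move i j k X \<in> majorised n L"
    unfolding move_in_majorised_iff[OF gl tot ij]
  proof
    fix \<theta>
    show "excess n X \<theta> - max 0 (X i - \<theta>) - max 0 (X j - \<theta>) + max 0 (X i - k - \<theta>) + max 0 (X j + k - \<theta>)
      \<le> excess n L \<theta>"
    proof (cases "u < \<theta> \<and> \<theta> < v")
      case True
      then have "excess n X \<theta> + 1 \<le> excess n L \<theta>" using pos[of \<theta>] by (simp add: D_def)
      moreover have "max 0 (X i - k - \<theta>) + max 0 (X j + k - \<theta>) \<le> max 0 (X i - \<theta>) + max 0 (X j - \<theta>) + 1"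
        by (auto simp: k_def max_def)
      ultimately show ?thesis by linarith
    next
      case False
      then have "max 0 (X i - k - \<theta>) + max 0 (X j + k - \<theta>) = max 0 (X i - \<theta>) + max 0 (X j - \<theta>)"
        using Xi Xj by (auto simp: k_def max_def)
      then show ?thesis using D0[of \<theta>] by (simp add: D_def)
    qed
  qed
  ultimately show ?thesis using ij by blast
qed

text \<open>
  If all excesses agree, \<open>X\<close> is a rearrangement of the decreasing vector \<open>L\<close>; being different from it,
  \<open>X\<close> has an ascent, and exchanging the two entries goes up.
\<close>

lemma ex_step_up:
  assumes X: "X \<in> majorised n L" and L: "L \<in> gl_weights n"
    and dec: "\<And>i. i \<in> {1..n} \<Longrightarrow> L (Suc i) \<le> L i" and neq: "X \<noteq> L"
  shows "\<exists>i j k. 1 \<le> i \<and> i < j \<and> j \<le> Suc n \<and> k \<noteq> 0 \<and> \<not> lowers (X i - X j) k \<and> move i j k X \<in> majorised n L"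
proof (cases "\<exists>\<theta>. excess n X \<theta> < excess n L \<theta>")
  case True
  then show ?thesis using ex_step_up_strict[OF X _ L] by blast
next
  case False
  have gl: "X \<in> gl_weights n" using X by (simp add: majorised_def)
  have ex: "excess n X \<theta> = excess n L \<theta>" for \<theta>
    using False X by (auto simp: majorised_def not_less intro: antisym)
  have dec_all: "Z j \<le> Z i" if Z: "\<forall>i\<in>{1..n}. Z (Suc i) \<le> Z i" and "1 \<le> i" "i \<le> j" "j \<le> Suc n"
    for Z :: weight and i j
    using that(3,4)
  proof (induction rule: dec_induct)
    case (step q)
    then have "Z (Suc q) \<le> Z q" "Z q \<le> Z i" using Z that(2) by auto
    then show ?case by simp
  qed simp
  have "\<exists>i\<in>{1..n}. X i < X (Suc i)"
  proof (rule ccontr)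
    assume "\<not> ?thesis"
    then have decX: "\<forall>i\<in>{1..n}. X (Suc i) \<le> X i" by auto
    have decL: "\<forall>i\<in>{1..n}. L (Suc i) \<le> L i" using dec by blast
    have "X = L"
      by (rule decreasing_eq_if_excess_eq[OF gl L dec_all[OF decX] dec_all[OF decL] ex])
    then show False using neq by simp
  qed
  then obtain i where i: "1 \<le> i" "i \<le> n" "X i < X (Suc i)" by auto
  let ?k = "X i - X (Suc i)"
  have "move i (Suc i) ?k X \<in> majorised n L"
    by (rule move_in_majorised[OF X]) (use i in auto)
  moreover have "\<not> lowers (X i - X (Suc i)) ?k" "?k \<noteq> 0" using i by (auto simp: lowers_def)
  ultimately show ?thesis
    using i by (intro exI[of _ i] exI[of _ "Suc i"] exI[of _ ?k]) auto
qed

lemma finite_majorised: "finite (majorised n L)"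
proof -
  let ?F = "{X. \<forall>i. (i \<in> {1..Suc n} \<longrightarrow> X i \<in> {total n L - excess n L 0..excess n L 0})
    \<and> (i \<notin> {1..Suc n} \<longrightarrow> X i = 0)}"
  have "X \<in> ?F" if X: "X \<in> majorised n L" for X
  proof -
    have "X \<in> gl_weights n" using X by (simp add: majorised_def)
    moreover have "X i \<in> {total n L - excess n L 0..excess n L 0}" for i
      using majorised_bounds(1,2)[OF X, of i] by auto
    ultimately show ?thesis by (auto simp: gl_weights_def)
  qed
  then have "majorised n L \<subseteq> ?F" by blast
  moreover have "finite ?F" by (rule finite_set_of_finite_funs) auto
  ultimately show ?thesis by (rule finite_subset)
qed

text \<open>
  Iterating the steps up must end, since there are finitely many majorised vectors and the rank
  increases; it can only end in \<open>L\<close>.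
\<close>

lemma majorised_imp_below:
  assumes "X \<in> majorised n L" and L: "L \<in> gl_weights n"
    and dec: "\<And>i. i \<in> {1..n} \<Longrightarrow> L (Suc i) \<le> L i"
  shows "bruhat_le n (weight_of n X) (weight_of n L)"
proof -
  let ?R = "{(Y, X). X \<in> majorised n L \<and> Y \<in> majorised n L \<and> rank_less n X Y}"
  have "wf ?R"
  proof (rule finite_acyclic_wf)
    have "?R \<subseteq> majorised n L \<times> majorised n L" by auto
    then show "finite ?R" by (rule finite_subset) (simp add: finite_majorised)
    have "trans ?R" by (auto simp: trans_def rank_less_def)
    moreover have "irrefl ?R" by (auto simp: irrefl_def rank_less_def)
    ultimately show "acyclic ?R" by (simp add: acyclic_irrefl)
  qed
  then show ?thesis
    using assms(1)
  proof (induction X rule: wf_induct_rule)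
    case (less X)
    show ?case
    proof (cases "X = L")
      case True
      then show ?thesis by (simp add: bruhat_le_def)
    next
      case False
      obtain i j k where ij: "1 \<le> i" "i < j" "j \<le> Suc n" and k: "k \<noteq> 0" "\<not> lowers (X i - X j) k"
        and Y: "move i j k X \<in> majorised n L"
        using ex_step_up[OF less.prems L dec False] by blast
      define Y where "Y = move i j k X"
      have undo: "move i j (- k) Y = X" using ij by (simp add: Y_def move_move move_zero)
      have "Y i - Y j = X i - X j - 2 * k" using ij by (simp add: Y_def move_def)
      then have l: "lowers (Y i - Y j) (- k)" using k by (auto simp: lowers_def)
      have "rank_less n X Y" using rank_less_move[OF ij l] undo by simp
      then have "bruhat_le n (weight_of n Y) (weight_of n L)"
        using less Y by (simp add: Y_def)
      moreover have "bruhat_step n (weight_of n X) (weight_of n Y)"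
        unfolding bruhat_step_weight_of using ij l undo by metis
      ultimately show ?thesis
        by (simp add: bruhat_le_def converse_rtranclp_into_rtranclp)
    qed
  qed
qed

lemma majorised_iff_below:
  assumes L: "L \<in> gl_weights n" and dec: "\<And>i. i \<in> {1..n} \<Longrightarrow> L (Suc i) \<le> L i"
    and X: "X \<in> gl_weights n" "total n X = total n L"
  shows "bruhat_le n (weight_of n X) (weight_of n L) \<longleftrightarrow> X \<in> majorised n L"
proof
  assume "bruhat_le n (weight_of n X) (weight_of n L)"
  then obtain Y where "Y \<in> majorised n L" "weight_of n X = weight_of n Y"
    using below_imp_majorised[OF _ L] by blast
  then show "X \<in> majorised n L"
    using weight_of_inject[of X n Y] X by (simp add: majorised_def)
qed (rule majorised_imp_below[OF _ L dec])

lemma dominant_lift: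
  assumes "lam \<in> dominant_weights n"
  shows "\<exists>L\<in>gl_weights n. weight_of n L = lam \<and> (\<forall>i\<in>{1..n}. L (Suc i) \<le> L i)"
proof -
  define L :: weight where "L = (\<lambda>i. if i \<in> {1..Suc n} then \<Sum>l\<in>{i..n}. lam l else 0)"
  have diff: "L i = lam i + L (Suc i)" if "i \<in> {1..n}" for i
    using that by (simp add: L_def sum.atLeast_Suc_atMost[of i n])
  have "weight_of n L = lam"
    using assms diff by (auto simp: weight_of_def fun_eq_iff dominant_weights_def weight_lattice_def)
  moreover have "\<forall>i\<in>{1..n}. L (Suc i) \<le> L i"
    using assms diff by (auto simp: dominant_weights_def)
  moreover have "L \<in> gl_weights n" by (simp add: L_def gl_weights_def)
  ultimately show ?thesis by blast
qed

section \<open>Labels and the reversed roots\<close>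

text \<open>
  The positive one among the affine roots \<open>\<plusminus>(r\<delta> + \<beta>\<^sup>\<or>)\<close> with \<open>\<beta> = e\<^sub>i - e\<^sub>j\<close>, so that one integer \<open>r\<close>
  parametrises all reflections in the direction of \<open>\<beta>\<close>.
\<close>

definition root_label :: "nat \<Rightarrow> nat \<Rightarrow> int \<Rightarrow> affine_root" where
  "root_label i j r = (if 0 \<le> r then (r, diff_root i j) else (- r, neg_root (diff_root i j)))"

lemma reflection_root_label:
  assumes "1 \<le> i" "i < j" "j \<le> Suc n"
  shows "affine_reflection n (root_label i j r) (weight_of n X) = weight_of n (move i j (X i - X j - r) X)"
  unfolding root_label_def using reflection_pos[OF assms, of r X] reflection_neg[OF assms, of "- r" X] by simp

lemma pos_real_roots_eq:
  "pos_real_roots n = {root_label i j r | i j r. 1 \<le> i \<and> i < j \<and> j \<le> Suc n}"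
proof (intro equalityI subsetI)
  fix a assume "a \<in> pos_real_roots n"
  then obtain r \<beta> where a: "a = (r, \<beta>)" and r: "\<beta> \<in> pos_roots n \<and> 0 \<le> r \<or> \<beta> \<in> neg_root ` pos_roots n \<and> 0 < r"
    by (auto simp: pos_real_roots_def roots_def)
  from r show "a \<in> {root_label i j r | i j r. 1 \<le> i \<and> i < j \<and> j \<le> Suc n}"
  proof
    assume "\<beta> \<in> pos_roots n \<and> 0 \<le> r"
    then obtain i j where "1 \<le> i" "i < j" "j \<le> Suc n" "a = root_label i j r"
      unfolding pos_roots_eq by (auto simp: a root_label_def)
    then show ?thesis by blast
  next
    assume "\<beta> \<in> neg_root ` pos_roots n \<and> 0 < r"
    then obtain i j where "1 \<le> i" "i < j" "j \<le> Suc n" "a = root_label i j (- r)"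
      unfolding pos_roots_eq by (auto simp: a root_label_def)
    then show ?thesis by blast
  qed
next
  fix a assume "a \<in> {root_label i j r | i j r. 1 \<le> i \<and> i < j \<and> j \<le> Suc n}"
  then obtain i j r where "a = root_label i j r" "1 \<le> i" "i < j" "j \<le> Suc n" by blast
  moreover from this have "diff_root i j \<in> pos_roots n" unfolding pos_roots_eq by blast
  ultimately show "a \<in> pos_real_roots n"
    by (auto simp: root_label_def pos_real_roots_def roots_def)
qed

lemma diff_root_inject:
  assumes "1 \<le> i" "i < j" "1 \<le> i'" "i' < j'"
  shows "diff_root i j = diff_root i' j' \<longleftrightarrow> i = i' \<and> j = j'"
proof
  assume eq: "diff_root i j = diff_root i' j'"
  have mem: "l \<in> {i..<j} \<longleftrightarrow> l \<in> {i'..<j'}" for l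
    using fun_cong[OF eq, of l] assms by (auto simp: diff_root_def alpha_def split: if_splits)
  show "i = i' \<and> j = j'"
    using mem[of i] mem[of i'] mem[of "j - 1"] mem[of "j' - 1"] assms by auto
qed simp

lemma diff_root_neq_neg:
  assumes "1 \<le> i" "i < j"
  shows "diff_root i j \<noteq> neg_root (diff_root i' j')" "neg_root (diff_root i' j') \<noteq> diff_root i j"
proof -
  have "diff_root i j i = 1" using assms by (auto simp: diff_root_def alpha_def)
  moreover have "neg_root (diff_root i' j') i \<le> 0" by (auto simp: neg_root_def diff_root_def alpha_def)
  ultimately show "diff_root i j \<noteq> neg_root (diff_root i' j')" "neg_root (diff_root i' j') \<noteq> diff_root i j"
    by auto
qed

lemma neg_root_inject: "neg_root \<beta> = neg_root \<gamma> \<longleftrightarrow> \<beta> = \<gamma>"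
  by (auto simp: neg_root_def fun_eq_iff)

lemma root_label_inject:
  assumes "1 \<le> i" "i < j" "1 \<le> i'" "i' < j'"
  shows "root_label i j r = root_label i' j' r' \<longleftrightarrow> i = i' \<and> j = j' \<and> r = r'"
  using diff_root_inject[OF assms] diff_root_neq_neg[OF assms(1,2), of i' j']
    diff_root_neq_neg[OF assms(3,4), of i j]
  by (auto simp: root_label_def neg_root_inject)

text \<open>
  The number of labels in the direction of \<open>e\<^sub>i - e\<^sub>j\<close> among the first \<open>m\<close> in the list: the list runs
  through \<open>j = n + 1\<close> in rounds of length \<open>n\<close>, and \<open>of_bool\<close> accounts for the unfinished round.
\<close>

definition twist_shift :: "nat \<Rightarrow> nat \<Rightarrow> nat \<Rightarrow> nat \<Rightarrow> int" where
  "twist_shift n m i j = (if j = Suc n then int (m div n) + of_bool (i < m mod n + 1) else 0)"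

lemma root_label_twisted_iff:
  assumes n: "1 \<le> n" and ij: "1 \<le> i" "i < j" "j \<le> Suc n"
  shows "root_label i j r \<in> twist_root n ` {..<m} \<longleftrightarrow> r < 0 \<and> - r \<le> twist_shift n m i j"
proof -
  have tw: "twist_root n q = root_label (q mod n + 1) (Suc n) (- (int (q div n) + 1))" for q
    by (simp add: twist_root_def root_label_def diff_root_def)
  have range: "1 \<le> q mod n + 1" "q mod n + 1 < Suc n" for q using n by auto
  have mem: "root_label i j r \<in> twist_root n ` {..<m} \<longleftrightarrow>
      (\<exists>q<m. i = q mod n + 1 \<and> j = Suc n \<and> r = - (int (q div n) + 1))"
    using root_label_inject[OF ij(1,2) range] by (auto simp: tw)
  show ?thesis
  proof
    assume "root_label i j r \<in> twist_root n ` {..<m}"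
    then obtain q where q: "q < m" "i = q mod n + 1" "j = Suc n" "r = - (int (q div n) + 1)"
      using mem by blast
    have "q div n \<le> m div n" using q(1) by (intro div_le_mono) simp
    moreover have "q mod n < m mod n" if "q div n = m div n"
      using q(1) that by (metis add_less_cancel_left mult_div_mod_eq)
    ultimately have "q div n + 1 \<le> m div n \<or> q div n = m div n \<and> q mod n < m mod n" by linarith
    then show "r < 0 \<and> - r \<le> twist_shift n m i j"
      using q by (auto simp: twist_shift_def)
  next
    assume r: "r < 0 \<and> - r \<le> twist_shift n m i j"
    then have j: "j = Suc n" by (auto simp: twist_shift_def split: if_splits)
    define d where "d = nat (- r - 1)"
    have rd: "r = - (int d + 1)" using r by (simp add: d_def)
    define q where "q = d * n + (i - 1)"
    have "i - 1 < n" using ij j by simp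
    then have qd: "q div n = d" "q mod n = i - 1" by (auto simp: q_def)
    have "d < m div n \<or> d = m div n \<and> i - 1 < m mod n"
      using r j ij by (cases "i < m mod n + 1") (auto simp: twist_shift_def rd)
    then have "q < m"
    proof
      assume "d < m div n"
      then have "(d + 1) * n \<le> m div n * n" by (intro mult_le_mono1) simp
      also have "\<dots> \<le> m" by simp
      finally show ?thesis using \<open>i - 1 < n\<close> by (simp add: q_def)
    next
      assume "d = m div n \<and> i - 1 < m mod n"
      then show ?thesis unfolding q_def by (metis add_less_cancel_left div_mult_mod_eq)
    qed
    then show "root_label i j r \<in> twist_root n ` {..<m}"
      unfolding mem using qd j rd ij by (intro exI[of _ q]) simp
  qed
qed

section \<open>In-degrees as sums over strings\<close>

definition index_pairs :: "nat \<Rightarrow> (nat \<times> nat) set" where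
  "index_pairs n = {(i, j). 1 \<le> i \<and> i < j \<and> j \<le> Suc n}"

text \<open>
  The arrows into \<open>X\<close> in the twisted graph along the direction \<open>e\<^sub>i - e\<^sub>j\<close>, each recorded by the \<open>k\<close> of
  its other end.
\<close>

definition in_moves :: "nat \<Rightarrow> nat \<Rightarrow> weight \<Rightarrow> weight \<Rightarrow> nat \<Rightarrow> nat \<Rightarrow> int set" where
  "in_moves n m L X i j = {k. move i j k X \<in> majorised n L \<and> lowers (X i - X j + twist_shift n m i j) k}"

lemma finite_index_pairs: "finite (index_pairs n)"
  by (rule finite_subset[of _ "{..Suc n} \<times> {..Suc n}"]) (auto simp: index_pairs_def)

lemma twist_shift_nonneg: "0 \<le> twist_shift n m i j"
  by (simp add: twist_shift_def)

text \<open>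
  Reversing the labels \<open>r = - 1, \<dots>, - s\<close> of a string translates its order by \<open>s\<close>; here \<open>r = p - k\<close> is the
  label of the move by \<open>k\<close>.
\<close>

lemma lowers_shift_iff:
  assumes "0 \<le> s"
  shows "lowers (p + s) k \<longleftrightarrow>
    (if p - k < 0 \<and> - (p - k) \<le> s then k \<noteq> 0 \<and> \<not> lowers p k else lowers p k)"
  using assms by (auto simp: lowers_def)

lemma lowers_set: "{k. lowers P k} = (if 0 \<le> P then {1..P} else {P + 1..- 1})"
  by (auto simp: lowers_def)

lemma finite_in_moves: "finite (in_moves n m L X i j)"
proof (rule finite_subset)
  show "in_moves n m L X i j \<subseteq> {k. lowers (X i - X j + twist_shift n m i j) k}"
    by (auto simp: in_moves_def)
qed (simp add: lowers_set)

text \<open>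
  An arrow incident with \<open>X\<close> is determined by its label, and the label by the direction \<open>(i, j)\<close> and the
  length \<open>k\<close> of the move.  The triple naming an arrow always puts its lower end first, also when the
  arrow is reversed, so \<open>X\<close> is the last component of the names of its unreversed incoming arrows and
  the first component of the names of the reversed ones.
\<close>

lemma Arr_eq_sum:
  assumes n: "1 \<le> n" and L: "L \<in> gl_weights n" and dec: "\<And>i. i \<in> {1..n} \<Longrightarrow> L (Suc i) \<le> L i"
    and X: "X \<in> majorised n L"
  shows "Arr n m (weight_of n X) (weight_of n L) = (\<Sum>(i, j)\<in>index_pairs n. card (in_moves n m L X i j))"
proof -
  let ?lam = "weight_of n L" and ?w = "weight_of n"
  let ?T = "twist_root n ` {..<m}"
  define arc where "arc = (\<lambda>((i, j), k). let e = root_label i j (X i - X j - k); Y = ?w (move i j k X)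
     in if lowers (X i - X j) k then (Y, e, ?w X) else (?w X, e, Y))"
  have arc: "arc ((i, j), k) = (if lowers (X i - X j) k
      then (?w (move i j k X), root_label i j (X i - X j - k), ?w X)
      else (?w X, root_label i j (X i - X j - k), ?w (move i j k X)))" for i j k
    by (simp add: arc_def Let_def)
  let ?S = "SIGMA (i, j):index_pairs n. in_moves n m L X i j"
  have gl: "Y \<in> gl_weights n \<and> total n Y = total n L" if "Y \<in> majorised n L" for Y
    using that by (simp add: majorised_def)
  have glX: "X \<in> gl_weights n" "total n X = total n L" using gl X by auto
  have below: "bruhat_le n (?w Y) ?lam" if "Y \<in> majorised n L" for Y
    using majorised_imp_below[OF that L dec] .
  have in_arcs_iff: "(\<nu>, a, \<nu>') \<in> in_arcs (twisted_bruhat_graph n m ?lam) (?w X) \<longleftrightarrow>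
      \<nu> \<in> weight_lattice n \<and> bruhat_le n \<nu> ?lam \<and> \<nu>' \<in> weight_lattice n \<and> bruhat_le n \<nu>' ?lam \<and>
      a \<in> pos_real_roots n \<and> affine_reflection n a \<nu> = \<nu>' \<and> bruhat_less n \<nu> \<nu>' \<and>
      (if a \<in> ?T then \<nu> else \<nu>') = ?w X" for \<nu> a \<nu>'
    by (auto simp: twisted_bruhat_graph_def bruhat_graph_def Let_def in_arcs_def)
  have crit: "k \<in> in_moves n m L X i j \<longleftrightarrow> move i j k X \<in> majorised n L \<and>
      (if root_label i j (X i - X j - k) \<in> ?T then k \<noteq> 0 \<and> \<not> lowers (X i - X j) k else lowers (X i - X j) k)"
    if "1 \<le> i" "i < j" "j \<le> Suc n" for i j k
    unfolding root_label_twisted_iff[OF n that] in_moves_def mem_Collect_eq lowers_shift_iff[OF twist_shift_nonneg] by simp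
  have "inj_on arc ?S"
  proof (rule inj_onI)
    fix x y assume x: "x \<in> ?S" and y: "y \<in> ?S" and eq: "arc x = arc y"
    obtain i j k i' j' k' where xy: "x = ((i, j), k)" "y = ((i', j'), k')" by (metis surj_pair)
    have "root_label i j (X i - X j - k) = root_label i' j' (X i' - X j' - k')"
      using eq unfolding xy arc by (auto split: if_splits)
    then have "i = i' \<and> j = j' \<and> X i - X j - k = X i' - X j' - k'"
      using x y root_label_inject[of i j i' j'] by (auto simp: xy index_pairs_def)
    then show "x = y" by (auto simp: xy)
  qed
  moreover have "arc ` ?S = in_arcs (twisted_bruhat_graph n m ?lam) (?w X)"
  proof (intro equalityI subsetI)
    fix e assume "e \<in> arc ` ?S"
    then obtain i j k where e: "e = arc ((i, j), k)" and ij: "1 \<le> i" "i < j" "j \<le> Suc n"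
      and k: "k \<in> in_moves n m L X i j"
      by (auto simp: index_pairs_def)
    let ?Y = "move i j k X" and ?r = "X i - X j - k"
    have Y: "?Y \<in> majorised n L" using k by (simp add: in_moves_def)
    have root: "root_label i j ?r \<in> pos_real_roots n" using ij by (auto simp: pos_real_roots_eq)
    have refl: "affine_reflection n (root_label i j ?r) (?w X) = ?w ?Y"
      by (simp add: reflection_root_label[OF ij])
    have "?Y i - ?Y j - ?r = - k" using ij by (simp add: move_def)
    then have refl': "affine_reflection n (root_label i j ?r) (?w ?Y) = ?w X"
      using ij by (simp add: reflection_root_label[OF ij] move_move move_zero)
    note basics = weight_of_in_lattice below[OF X] below[OF Y] root refl refl' bruhat_less_move_iff[OF glX(1) ij, of k]
    show "e \<in> in_arcs (twisted_bruhat_graph n m ?lam) (?w X)"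
    proof (cases "lowers (X i - X j) k")
      case True
      then show ?thesis
        unfolding e arc using crit[OF ij, of k] k basics by (simp only: in_arcs_iff if_True) (simp split: if_splits)
    next
      case False
      then show ?thesis
        unfolding e arc using crit[OF ij, of k] k basics by (simp only: in_arcs_iff if_False) (simp split: if_splits)
    qed
  next
    fix e assume e: "e \<in> in_arcs (twisted_bruhat_graph n m ?lam) (?w X)"
    obtain \<nu> a \<nu>' where e_eq: "e = (\<nu>, a, \<nu>')" by (metis surj_pair)
    have \<nu>: "bruhat_le n \<nu> ?lam" "bruhat_le n \<nu>' ?lam" and a: "a \<in> pos_real_roots n"
      and refl: "affine_reflection n a \<nu> = \<nu>'" and less: "bruhat_less n \<nu> \<nu>'"
      and head: "(if a \<in> ?T then \<nu> else \<nu>') = ?w X"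
      using e unfolding e_eq in_arcs_iff by blast+
    obtain i j r where ij: "1 \<le> i" "i < j" "j \<le> Suc n" and a_eq: "a = root_label i j r"
      using a unfolding pos_real_roots_eq by blast
    define k where "k = X i - X j - r"
    have r: "X i - X j - k = r" by (simp add: k_def)
    have other: "if a \<in> ?T then \<nu> = ?w X \<and> \<nu>' = ?w (move i j k X)
      else \<nu>' = ?w X \<and> \<nu> = ?w (move i j k X)"
    proof (cases "a \<in> ?T")
      case True
      then have "\<nu> = ?w X" using head by simp
      then have "\<nu>' = ?w (move i j k X)"
        using refl unfolding a_eq by (simp add: reflection_root_label[OF ij] k_def)
      then show ?thesis using True \<open>\<nu> = ?w X\<close> by auto
    next
      case False
      then have X': "\<nu>' = ?w X" using head by simp
      obtain Y where Y: "Y \<in> majorised n L" "\<nu> = ?w Y" using below_imp_majorised[OF \<nu>(1) L] by blast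
      define k' where "k' = Y i - Y j - r"
      have "?w (move i j k' Y) = ?w X"
        using refl unfolding a_eq Y(2) X' by (simp add: reflection_root_label[OF ij] k'_def)
      then have XY: "X = move i j k' Y"
        using weight_of_inject[of X n "move i j k' Y"] glX gl[OF Y(1)] move_in_gl_weights[OF _ ij] total_move[OF ij]
        by metis
      have "k = - k'" unfolding k_def XY using ij by (simp add: move_def k'_def)
      then have "Y = move i j k X" unfolding XY using ij by (simp add: move_move move_zero)
      then show ?thesis using Y X' False by auto
    qed
    then have "bruhat_le n (?w (move i j k X)) ?lam" using \<nu> by (metis (full_types))
    then have Y: "move i j k X \<in> majorised n L"
      using majorised_iff_below[OF L dec, of "move i j k X"] glX move_in_gl_weights[OF _ ij] total_move[OF ij]
      by simp
    have "k \<in> in_moves n m L X i j \<and> e = arc ((i, j), k)"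
      unfolding crit[OF ij] arc e_eq r a_eq[symmetric]
      using Y other less bruhat_less_move_iff[OF glX(1) ij, of k] by (cases "a \<in> ?T") auto
    then show "e \<in> arc ` ?S" using ij by (auto simp: index_pairs_def intro!: image_eqI[of _ _ "((i, j), k)"])
  qed
  ultimately have "card ?S = Arr n m (?w X) ?lam"
    unfolding Arr_def in_degree_def by (metis card_image)
  moreover have "card ?S = (\<Sum>(i, j)\<in>index_pairs n. card (in_moves n m L X i j))"
    by (subst card_SigmaI) (auto simp: finite_index_pairs finite_in_moves case_prod_beta)
  ultimately show ?thesis by simp
qed

text \<open>
  The number of elements that a string, continued indefinitely, has below the element of pairing \<open>P\<close>.
\<close>

definition depth :: "int \<Rightarrow> int" where
  "depth P = (if 0 \<le> P then P else - 1 - P)"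

text \<open>
  This symmetry absorbs the choice of sign in \<open>\<plusminus>(e\<^sub>i - e\<^sub>J)\<close>.
\<close>

lemma depth_reflect: "depth (- 1 - P) = depth P"
  by (auto simp: depth_def)

lemma card_lowers: "int (card {k. lowers P k}) = depth P"
  by (simp add: lowers_set depth_def)

text \<open>
  The elements below \<open>X\<close> on its string that fail to be majorised by \<open>L\<close>, counted from the far end
  \<open>k = P\<close> of the string; measured this way, the lost elements for \<open>X\<close> and for \<open>t X\<close> turn out to
  have the same positions \<open>l\<close>.
\<close>

definition lost :: "nat \<Rightarrow> weight \<Rightarrow> weight \<Rightarrow> nat \<Rightarrow> nat \<Rightarrow> int \<Rightarrow> int set" where
  "lost n L X i j P = {l. 0 \<le> l \<and> l < P \<and> move i j (P - l) X \<notin> majorised n L}"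

text \<open>
  Moves with \<open>k < 0\<close> stay between \<open>X\<close> and its mirror image on the string, because the shift is not
  negative; so nothing is lost there, and all lost moves have \<open>k > 0\<close>.
\<close>

lemma card_in_moves:
  assumes X: "X \<in> majorised n L" and ij: "1 \<le> i" "i < j" "j \<le> Suc n"
    and P: "P = X i - X j + twist_shift n m i j"
  shows "int (card (in_moves n m L X i j)) = depth P - int (card (lost n L X i j P))"
proof -
  let ?A = "{k. lowers P k}"
  have fin: "finite ?A" by (simp add: lowers_set)
  have sub: "in_moves n m L X i j \<subseteq> ?A" by (auto simp: in_moves_def P)
  have "?A - in_moves n m L X i j = (\<lambda>l. P - l) ` lost n L X i j P"
  proof (intro equalityI subsetI)
    fix k assume k: "k \<in> ?A - in_moves n m L X i j"
    then have out: "move i j k X \<notin> majorised n L" and l: "lowers P k" by (auto simp: in_moves_def P)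
    have "0 < k"
    proof (rule ccontr)
      assume "\<not> 0 < k"
      then have "X i - X j \<le> k \<and> k \<le> 0"
        using l twist_shift_nonneg[of n m i j] by (auto simp: lowers_def P)
      then show False using move_in_majorised[OF X ij] out by blast
    qed
    then have "P - k \<in> lost n L X i j P" using l out by (auto simp: lost_def lowers_def)
    then show "k \<in> (\<lambda>l. P - l) ` lost n L X i j P" by (intro image_eqI[of _ _ "P - k"]) auto
  next
    fix k assume "k \<in> (\<lambda>l. P - l) ` lost n L X i j P"
    then show "k \<in> ?A - in_moves n m L X i j" by (auto simp: lost_def in_moves_def lowers_def)
  qed
  moreover have "card ((\<lambda>l. P - l) ` lost n L X i j P) = card (lost n L X i j P)"
    by (rule card_image) (simp add: inj_on_def)
  ultimately have "card (lost n L X i j P) = card ?A - card (in_moves n m L X i j)"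
    using card_Diff_subset[OF finite_subset[OF sub fin] sub] by simp
  moreover have "card (in_moves n m L X i j) \<le> card ?A" by (rule card_mono[OF fin sub])
  ultimately show ?thesis using card_lowers[of P] by simp
qed

lemma lost_untwisted:
  assumes "X \<in> majorised n L" "1 \<le> i" "i < j" "j \<le> Suc n" "P \<le> X i - X j"
  shows "lost n L X i j P = {}"
  using move_in_majorised[OF assms(1-4)] assms(5) by (auto simp: lost_def)

lemma card_in_moves_untwisted:
  assumes X: "X \<in> majorised n L" and ij: "1 \<le> i" "i < j" "j \<le> n"
  shows "int (card (in_moves n m L X i j)) = depth (X i - X j)"
proof -
  have j: "j \<le> Suc n" and s: "twist_shift n m i j = 0" using ij(3) by (auto simp: twist_shift_def)
  show ?thesis
    using card_in_moves[OF X ij(1,2) j refl, of m] lost_untwisted[OF X ij(1,2) j, of "X i - X j"]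
    by (simp add: s)
qed

section \<open>Comparing the two ends of the next edge\<close>

text \<open>
  Write \<open>y, a, b\<close> for the entries of \<open>X\<close> at \<open>i, J, n + 1\<close> and \<open>C = c + e\<close>.  All vectors involved
  agree with \<open>X\<close> outside these three positions.  There the \<open>l\<close>-th move from the far end turns \<open>X\<close>
  into \<open>{b - C + l, a, y + C - l}\<close> and \<open>Z\<close> into \<open>{a + 1 - e + l, b - c - 1, y + C - l}\<close>, and \<open>Z\<close>
  itself has \<open>{y, b - c - 1, a + c + 1}\<close>.  The second triple majorises the first, which gives one
  direction.  Conversely, as long as \<open>l < y - a - 1 + e\<close>, the excess of the second triple is at
  each threshold at most that of the first or that of \<open>Z\<close>: the former for thresholds from
  \<open>a + 1 - e + l\<close> on, the latter below.  For larger \<open>l\<close> the first triple is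
  majorised by \<open>Z\<close>, so there nothing is lost.
\<close>

lemma lost_eq:
  fixes c e :: int
  assumes X: "X \<in> majorised n L" and J: "1 \<le> J" "J \<le> n" and i: "1 \<le> i" "i \<le> n" "i \<noteq> J"
    and k: "k = X J - X (Suc n) + c + 1" "0 < k" and c: "0 \<le> c" and e: "e = 0 \<or> e = 1"
    and Z: "Z = move J (Suc n) k X" "Z \<in> majorised n L"
  shows "lost n L X i (Suc n) (X i - X (Suc n) + c + e) = lost n L Z i (Suc n) (X i - X J - 1 + e)"
proof -
  let ?N = "Suc n" and ?P = "X i - X (Suc n) + c + e" and ?Q = "X i - X J - 1 + e"
  have JN: "J < ?N" "?N \<le> ?N" and iN: "i < ?N" using J i by auto
  have gl: "X \<in> gl_weights n" "total n X = total n L" "Z \<in> gl_weights n" "total n Z = total n L"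
    using X Z(2) by (auto simp: majorised_def)
  have Zi: "Z i = X i" and ZN: "Z ?N = X ?N + k" using i J by (auto simp: Z(1) move_def)
  note exZ = excess_move[OF J(1) JN, of k X, folded Z(1)]
  have Zle: "excess n Z \<theta> \<le> excess n L \<theta>" for \<theta> using Z(2) by (simp add: majorised_def)
  have unlost: "move i ?N (?P - l) X \<in> majorised n L" if "0 \<le> l" "l < ?P" "?Q \<le> l" for l
    unfolding move_in_majorised_iff[OF gl(1,2) i(1) iN JN(2)]
  proof
    fix \<theta>
    show "excess n X \<theta> - max 0 (X i - \<theta>) - max 0 (X ?N - \<theta>) + max 0 (X i - (?P - l) - \<theta>)
      + max 0 (X ?N + (?P - l) - \<theta>) \<le> excess n L \<theta>"
      using Zle[of \<theta>] that k c e unfolding exZ by (smt (verit))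
  qed
  have iff: "move i ?N (?P - l) X \<in> majorised n L \<longleftrightarrow> move i ?N (?Q - l) Z \<in> majorised n L"
    if "0 \<le> l" "l < ?Q" for l
    unfolding move_in_majorised_iff[OF gl(1,2) i(1) iN JN(2)] move_in_majorised_iff[OF gl(3,4) i(1) iN JN(2)]
  proof (rule iff_allI)
    fix \<theta>
    show "(excess n X \<theta> - max 0 (X i - \<theta>) - max 0 (X ?N - \<theta>) + max 0 (X i - (?P - l) - \<theta>)
      + max 0 (X ?N + (?P - l) - \<theta>) \<le> excess n L \<theta>) \<longleftrightarrow>
      (excess n Z \<theta> - max 0 (Z i - \<theta>) - max 0 (Z ?N - \<theta>) + max 0 (Z i - (?Q - l) - \<theta>)
      + max 0 (Z ?N + (?Q - l) - \<theta>) \<le> excess n L \<theta>)"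
      using Zle[of \<theta>] that k c e unfolding exZ Zi ZN by (smt (verit))
  qed
  have less: "?Q < ?P" using k by simp
  show ?thesis
    unfolding lost_def
  proof (rule Collect_cong)
    fix l
    show "0 \<le> l \<and> l < ?P \<and> move i ?N (?P - l) X \<notin> majorised n L \<longleftrightarrow>
      0 \<le> l \<and> l < ?Q \<and> move i ?N (?Q - l) Z \<notin> majorised n L"
    proof (cases "0 \<le> l \<and> l < ?Q")
      case True
      then have "l < ?P" using less by linarith
      then show ?thesis using True iff[of l] by blast
    next
      case False
      then show ?thesis using unlost[of l] less by (metis not_less)
    qed
  qed
qed

text \<open>
  The grouping of the positive roots that the reflection in \<open>e\<^sub>J - e\<^sub>n\<^sub>+\<^sub>1\<close> suggests: this root,
  the pairs of roots it exchanges up to sign, and the roots orthogonal to it.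
\<close>

lemma sum_index_pairs:
  fixes g :: "nat \<times> nat \<Rightarrow> int"
  assumes J: "1 \<le> J" "J \<le> n"
  shows "(\<Sum>p\<in>index_pairs n. g p) = g (J, Suc n)
    + (\<Sum>i\<in>{1..n} - {J}. g (min i J, max i J) + g (i, Suc n))
    + (\<Sum>p\<in>{(i, j). 1 \<le> i \<and> i < j \<and> j \<le> n \<and> i \<noteq> J \<and> j \<noteq> J}. g p)"
proof -
  let ?S = "{1..n} - {J}" and ?R = "{(i, j). 1 \<le> i \<and> i < j \<and> j \<le> n \<and> i \<noteq> J \<and> j \<noteq> J}"
  let ?A = "(\<lambda>i. (min i J, max i J)) ` ?S" and ?B = "(\<lambda>i. (i, Suc n)) ` ?S"
  have "index_pairs n = insert (J, Suc n) ((?A \<union> ?B) \<union> ?R)" (is "_ = ?U")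
  proof (intro equalityI subsetI)
    fix p assume "p \<in> index_pairs n"
    then obtain i j where p: "p = (i, j)" "1 \<le> i" "i < j" "j \<le> Suc n" by (auto simp: index_pairs_def)
    consider "i = J" "j = Suc n" | "i \<noteq> J" "j = Suc n" | "i = J" "j \<le> n" | "j = J" | "i \<noteq> J" "j \<noteq> J" "j \<le> n"
      using p by linarith
    then show "p \<in> ?U"
    proof cases
      case 2
      then have "p \<in> ?B" using p by auto
      then show ?thesis by blast
    next
      case 3
      then have "p \<in> ?A" using p by (intro image_eqI[of _ _ j]) auto
      then show ?thesis by blast
    next
      case 4
      then have "p \<in> ?A" using p J by (intro image_eqI[of _ _ i]) auto
      then show ?thesis by blast
    qed (use p in auto)
  next
    fix p assume "p \<in> ?U"
    then show "p \<in> index_pairs n" using J by (auto simp: index_pairs_def min_def max_def)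
  qed
  moreover have fin: "finite ?R"
    by (rule finite_subset[of _ "{..n} \<times> {..n}"]) auto
  moreover have "(J, Suc n) \<notin> (?A \<union> ?B) \<union> ?R" "(?A \<union> ?B) \<inter> ?R = {}" "?A \<inter> ?B = {}"
    using J by (auto simp: min_def max_def split: if_splits)
  ultimately have "(\<Sum>p\<in>index_pairs n. g p) = g (J, Suc n) + ((\<Sum>p\<in>?A. g p) + (\<Sum>p\<in>?B. g p) + (\<Sum>p\<in>?R. g p))"
    by (simp add: sum.union_disjoint)
  moreover have "inj_on (\<lambda>i. (min i J, max i J)) ?S" "inj_on (\<lambda>i. (i, Suc n)) ?S"
    by (auto simp: inj_on_def min_def max_def split: if_splits)
  ultimately show ?thesis
    by (simp add: sum.reindex sum.distrib o_def)
qed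

text \<open>
  The shifted pairings of \<open>X\<close> and \<open>Z\<close> on their common string are \<open>k - 1 \<ge> 0\<close> and \<open>- k - 1\<close>, of depths
  \<open>k - 1\<close> and \<open>k\<close>; everything below them lies between \<open>X\<close> and \<open>Z\<close>, so none of it is lost.  In each
  other group of strings the depths for \<open>X\<close> and \<open>Z\<close> are the same up to order, and so are the
  losses.
\<close>

lemma sum_in_moves_reflection:
  assumes n: "1 \<le> n" and X: "X \<in> majorised n L"
    and J: "J = m mod n + 1" and k: "k = X J - X (Suc n) + int (m div n) + 1" "0 < k"
    and Z: "Z = move J (Suc n) k X" "Z \<in> majorised n L"
  shows "(\<Sum>(i, j)\<in>index_pairs n. int (card (in_moves n m L Z i j)))
    = (\<Sum>(i, j)\<in>index_pairs n. int (card (in_moves n m L X i j))) + 1"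
proof -
  let ?N = "Suc n" and ?c = "int (m div n)"
  let ?d = "\<lambda>Y i j. int (card (in_moves n m L Y i j))"
  have J1: "1 \<le> J" "J \<le> n" "J < ?N" using n by (auto simp: J less_Suc_eq_le[symmetric] Suc_le_eq)
  have Zi: "Z i = X i" if "i \<noteq> J" "i \<noteq> ?N" for i
    using J1 that by (auto simp: Z(1) move_def)
  have ZJ: "Z J = X J - k" and ZN: "Z ?N = X ?N + k"
    using J1 by (auto simp: Z(1) move_def)
  have sJ: "twist_shift n m J ?N = ?c" by (simp add: twist_shift_def J)
  have edge: "?d Z J ?N = ?d X J ?N + 1"
  proof -
    have "lost n L X J ?N (k - 1) = {}"
    proof -
      have "move J ?N q X \<in> majorised n L" if "0 < q" "q < k" for q
      proof -
        have "move J ?N (q - k) Z = move J ?N q X" using J1 by (simp add: Z(1) move_move)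
        moreover have "move J ?N (q - k) Z \<in> majorised n L"
          by (rule move_in_majorised[OF Z(2)]) (use J1 that k ZJ ZN in auto)
        ultimately show ?thesis by simp
      qed
      then show ?thesis by (auto simp: lost_def)
    qed
    then have "?d X J ?N = k - 1"
      using card_in_moves[OF X J1(1,3) order_refl, of "k - 1" m] k by (simp add: sJ depth_def)
    moreover have "lost n L Z J ?N (- k - 1) = {}" using k by (auto simp: lost_def)
    then have "?d Z J ?N = k"
      using card_in_moves[OF Z(2) J1(1,3) order_refl, of "- k - 1" m] k by (simp add: sJ depth_def ZJ ZN)
    ultimately show ?thesis by simp
  qed
  have pair: "?d Z (min i J) (max i J) + ?d Z i ?N = ?d X (min i J) (max i J) + ?d X i ?N"
    if "i \<in> {1..n} - {J}" for i
  proof -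
    have i: "1 \<le> i" "i \<le> n" "i \<noteq> J" "i < ?N" using that by auto
    define e :: int where "e = of_bool (i < J)"
    have s: "twist_shift n m i ?N = ?c + e" by (simp add: twist_shift_def e_def J)
    let ?P = "X i - X ?N + ?c + e" and ?Q = "X i - X J - 1 + e"
    have lost: "lost n L X i ?N ?P = lost n L Z i ?N ?Q"
      by (rule lost_eq[OF X J1(1,2) i(1-3) k _ _ Z]) (auto simp: e_def)
    have "?d X i ?N = depth ?P - int (card (lost n L X i ?N ?P))"
      by (rule card_in_moves[OF X i(1,4) order_refl]) (simp add: s)
    moreover have "?d Z i ?N = depth ?Q - int (card (lost n L X i ?N ?P))"
      unfolding lost by (rule card_in_moves[OF Z(2) i(1,4) order_refl]) (use i k Zi[of i] ZN in \<open>simp add: s\<close>)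
    moreover have "1 \<le> min i J" "min i J < max i J" "max i J \<le> n" using i J1 by auto
    note mm = this
    have "?d X (min i J) (max i J) = depth ?Q"
      unfolding card_in_moves_untwisted[OF X mm] using i depth_reflect[of ?Q] by (cases "i < J") (auto simp: e_def)
    moreover have "?d Z (min i J) (max i J) = depth ?P"
    proof (cases "i < J")
      case True
      then have "Z i - Z J = ?P" using i Zi[of i] ZJ k by (simp add: e_def)
      then show ?thesis unfolding card_in_moves_untwisted[OF Z(2) mm] using True by simp
    next
      case False
      then have "Z J - Z i = - 1 - ?P" using i Zi[of i] ZJ k by (simp add: e_def)
      then show ?thesis
        unfolding card_in_moves_untwisted[OF Z(2) mm] using False depth_reflect[of ?P] by simp
    qed
    ultimately show ?thesis by simp
  qed
  have rest: "?d Z i j = ?d X i j" if "1 \<le> i" "i < j" "j \<le> n" "i \<noteq> J" "j \<noteq> J" for i j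
    using card_in_moves_untwisted[OF X that(1-3)] card_in_moves_untwisted[OF Z(2) that(1-3)] that Zi by simp
  show ?thesis
    unfolding sum_index_pairs[OF J1(1,2)] prod.case edge
    using pair rest by (simp add: case_prod_beta)
qed

theorem proposition3:
  fixes n m :: nat and lam \<mu> :: weight
  assumes "n \<ge> 1"
    and "lam \<in> dominant_weights n"
    and "\<mu> \<in> weight_lattice n"
    and "bruhat_less n \<mu> (affine_reflection n (twist_root n m) \<mu>)"
    and "bruhat_le n (affine_reflection n (twist_root n m) \<mu>) lam"
  shows "int (Arr n m \<mu> lam) = int (Arr n m (affine_reflection n (twist_root n m) \<mu>) lam) - 1"
proof -
  obtain L where L: "L \<in> gl_weights n" and lam: "lam = weight_of n L"
    and "\<forall>i\<in>{1..n}. L (Suc i) \<le> L i"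
    using dominant_lift[OF assms(2)] by blast
  then have dec: "\<And>i. i \<in> {1..n} \<Longrightarrow> L (Suc i) \<le> L i" by blast
  have "bruhat_le n \<mu> lam"
    using assms(4,5) unfolding bruhat_less_def bruhat_le_def by auto
  then obtain X where X: "X \<in> majorised n L" and \<mu>: "\<mu> = weight_of n X"
    using below_imp_majorised[OF _ L] lam by blast
  define J where "J = m mod n + 1"
  define k where "k = X J - X (Suc n) + int (m div n) + 1"
  define Z where "Z = move J (Suc n) k X"
  have J: "1 \<le> J" "J < Suc n" "Suc n \<le> Suc n" using assms(1) by (auto simp: J_def)
  have glX: "X \<in> gl_weights n" "total n X = total n L" using X by (auto simp: majorised_def)
  have "twist_root n m = (int (m div n) + 1, neg_root (diff_root J (Suc n)))"
    by (simp add: twist_root_def diff_root_def J_def)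
  then have t\<mu>: "affine_reflection n (twist_root n m) \<mu> = weight_of n Z"
    unfolding \<mu> Z_def k_def by (simp only: reflection_neg[OF J]) (simp add: algebra_simps)
  have Z: "Z \<in> majorised n L"
    using majorised_iff_below[OF L dec, of Z] assms(5) move_in_gl_weights[OF glX(1) J] total_move[OF J] glX(2)
    unfolding t\<mu> lam by (simp add: Z_def)
  have "k \<noteq> 0 \<and> \<not> lowers (X J - X (Suc n)) k"
    using assms(4) bruhat_less_move_iff(2)[OF glX(1) J, of k] unfolding t\<mu> unfolding \<mu> Z_def by simp
  then have "0 < k" by (auto simp: lowers_def k_def)
  have Arr: "int (Arr n m (weight_of n Y) lam) = (\<Sum>(i, j)\<in>index_pairs n. int (card (in_moves n m L Y i j)))"
    if "Y \<in> majorised n L" for Y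
    using Arr_eq_sum[OF assms(1) L _ that, of m] dec unfolding lam by (simp add: case_prod_beta)
  show ?thesis
    unfolding t\<mu> unfolding \<mu> Arr[OF X] Arr[OF Z]
    using sum_in_moves_reflection[OF assms(1) X J_def k_def \<open>0 < k\<close> Z_def Z] by simp
qed

end
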